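(* Let $r\ge2$, let $p_1,\dots,p_r$ be constants with $p_r\ne0$, let $(\tilde F^{(r)}_n)_{n\ge0}$ be the impulse response sequence with respect to $\{p_1,\dots,p_r\}$, and let $(a_n)_{n\in\mathbb Z}$ be a sequence satisfying $a_n=\sum_{j=1}^rp_ja_{n-j}$ for all integers $n$ (i.e. a sequence satisfying the recurrence for $n\ge r$, extended uniquely to negative indices using the recurrence, which is possible since $p_r\neq0$). Let $\mathbf e_r=(0,\dots,0,1)^T\in\mathbb R^r$. (i) If $r$ is even, suppose $\mathbf c=(c_{r/2},c_{r/2+1},\dots,c_{r-1},c_r,c_{r+1},\dots,c_{3r/2-1})^T$ satisfies $A_e\mathbf c=\mathbf e_r$, where $A_e$ is the $r\times r$ matrix whose row indexed by $n=0,1,\dots,r-1$ is $$\left(a_{n+r/2},a_{n+r/2-1},\dots,a_{n+1},\ a_{n-1},a_{n-2},\dots,a_{n-r/2}\right)$$ (so the first row is $(a_{r/2},\dots,a_1,a_{-1},\dots,a_{-r/2})$ and the last row is $(a_{3r/2-1},\dots,a_r,a_{r-2},\dots,a_{r/2-1})$). Then for all $n\ge0$, $$\tilde F^{(r)}_n=\sum_{j=r/2}^{r-1}c_ja_{n+r-j}+\sum_{j=r}^{3r/2-1}c_ja_{n+r-j-1}.$$ (ii) If $r$ is odd, suppose $\mathbf c=(c_{(r-1)/2},c_{(r-1)/2+1},\dots,c_{3(r-1)/2})^T$ satisfies $A_o\mathbf c=\mathbf e_r$, where $A_o$ is the $r\times r$ Toeplitz matrix whose row indexed by $n=0,1,\dots,r-1$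 is $$\left(a_{n+(r-1)/2},a_{n+(r-1)/2-1},\dots,a_{n-(r-1)/2}\right).$$ Then for all $n\ge0$, $$\tilde F^{(r)}_n=\sum_{j=(r-1)/2}^{3(r-1)/2}c_ja_{n+r-j-1}.$$ (iii) If the block Toeplitz matrix $A_e$ (for even $r$), respectively the Toeplitz matrix $A_o$ (for odd $r$), is invertible, then the coefficient vector $\mathbf c$ in the corresponding expression exists and is unique.
   Context: The impulse response sequence (IRS) with respect to $\{p_1,\dots,p_r\}$ is the sequence $(\tilde F^{(r)}_n)_{n\ge0}$ with $\tilde F^{(r)}_n=\sum_{j=1}^rp_j\tilde F^{(r)}_{n-j}$ for $n\ge r$, $\tilde F^{(r)}_0=\dots=\tilde F^{(r)}_{r-2}=0$, $\tilde F^{(r)}_{r-1}=1$. *)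

theory Defs
  imports "Jordan_Normal_Form.Matrix"
begin

function impulse_response :: "nat \<Rightarrow> (nat \<Rightarrow> 'a :: field) \<Rightarrow> nat \<Rightarrow> 'a" where
  "impulse_response r p n =
     (if n < r then (if n = r - 1 then 1 else 0)
      else (\<Sum>j = 1..r. p j * impulse_response r p (n - j)))"
  by pat_completeness auto
termination
  by (relation "measure (\<lambda>(r, p, n). n)") auto

declare impulse_response.simps [simp del]

lemma impulse_response_init:
  assumes "r \<ge> 2"
  shows "\<And>n. n \<le> r - 2 \<Longrightarrow> impulse_response r p n = 0"
    and "impulse_response r p (r - 1) = 1"
  using assms by (auto simp: impulse_response.simps)

lemma impulse_response_rec:
  assumes "n \<ge> r"
  shows "impulse_response r p n = (\<Sum>j = 1..r. p j * impulse_response r p (n - j))"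
  using assms by (subst impulse_response.simps) simp

definition satisfies_recurrence :: "nat \<Rightarrow> (nat \<Rightarrow> 'a :: field) \<Rightarrow> (int \<Rightarrow> 'a) \<Rightarrow> bool" where
  "satisfies_recurrence r p a \<longleftrightarrow> (\<forall>n. a n = (\<Sum>j = 1..r. p j * a (n - int j)))"

text \<open>Row \<open>n\<close> is \<open>a (n + r/2), \<dots>, a (n + 1), a (n - 1), \<dots>, a (n - r/2)\<close>: the entry \<open>a n\<close> is
  skipped, whence the extra \<open>- 1\<close> in the right half of the columns.\<close>
definition A_even :: "nat \<Rightarrow> (int \<Rightarrow> 'a :: field) \<Rightarrow> 'a mat" where
  "A_even r a = mat r r (\<lambda>(n, k).
     if k < r div 2 then a (int n + int (r div 2) - int k)
     else a (int n + int (r div 2) - int k - 1))"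

definition A_odd :: "nat \<Rightarrow> (int \<Rightarrow> 'a :: field) \<Rightarrow> 'a mat" where
  "A_odd r a = mat r r (\<lambda>(n, k). a (int n + int ((r - 1) div 2) - int k))"

text \<open>Vectors are indexed from \<open>0\<close>, so the coefficient \<open>c\<^sub>j\<close>, whose index starts at \<open>r/2\<close>
  for even \<open>r\<close> and at \<open>(r - 1)/2\<close> for odd \<open>r\<close>, is the vector entry at \<open>j - r/2\<close>,
  respectively \<open>j - (r - 1)/2\<close>.\<close>
definition expansion_even :: "nat \<Rightarrow> (int \<Rightarrow> 'a :: field) \<Rightarrow> 'a vec \<Rightarrow> nat \<Rightarrow> 'a" where
  "expansion_even r a c n =
     (\<Sum>j = r div 2..r - 1. c $ (j - r div 2) * a (int n + int r - int j)) +
     (\<Sum>j = r..3 * r div 2 - 1. c $ (j - r div 2) * a (int n + int r - int j - 1))"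

definition expansion_odd :: "nat \<Rightarrow> (int \<Rightarrow> 'a :: field) \<Rightarrow> 'a vec \<Rightarrow> nat \<Rightarrow> 'a" where
  "expansion_odd r a c n =
     (\<Sum>j = (r - 1) div 2..3 * (r - 1) div 2.
        c $ (j - (r - 1) div 2) * a (int n + int r - int j - 1))"

end

theory Submission
  imports Defs
begin

text \<open>Row \<open>n\<close> of \<open>A c\<close> is the proposed expansion at \<open>n\<close>, and the expansion is a linear combination of
  shifts of \<open>a\<close>, so it satisfies the recurrence. Hence \<open>A c = e\<^sub>r\<close> says exactly that the expansion has
  the initial values of the impulse response sequence, which is equivalent to equality everywhere.\<close>

text \<open>Uniqueness for given initial values: since \<open>j \<ge> 1\<close>, the recurrence
  refers only to earlier terms, so strong induction applies.\<close>

lemma impulse_response_eqI: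
  assumes "\<And>n. n < r \<Longrightarrow> f n = (if n = r - 1 then 1 else 0)"
    and "\<And>n. n \<ge> r \<Longrightarrow> f n = (\<Sum>j = 1..r. p j * f (n - j))"
  shows "impulse_response r p n = f n"
proof (induction n rule: less_induct)
  case (less n)
  show ?case
  proof (cases "n < r")
    case True
    then show ?thesis by (simp add: assms(1) impulse_response.simps)
  next
    case False
    then have "impulse_response r p n = (\<Sum>j = 1..r. p j * f (n - j))"
      by (subst impulse_response_rec) (auto intro!: sum.cong simp: less)
    also have "\<dots> = f n" using False assms(2) by simp
    finally show ?thesis .
  qed
qed

text \<open>The recurrence is linear and its coefficients do not depend on \<open>n\<close>, so its
  solutions on the integers are closed under shifts, forward or backward, and under linear
  combinations.\<close>

lemma satisfies_recurrence_sum_shifts: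
  assumes "satisfies_recurrence r p a"
  shows "satisfies_recurrence r p (\<lambda>n. \<Sum>k\<in>K. c k * a (n + s k))"
  unfolding satisfies_recurrence_def
proof
  fix n
  have "(\<Sum>k\<in>K. c k * a (n + s k)) = (\<Sum>k\<in>K. c k * (\<Sum>j = 1..r. p j * a (n + s k - int j)))"
    using assms unfolding satisfies_recurrence_def by metis
  also have "\<dots> = (\<Sum>k\<in>K. \<Sum>j = 1..r. p j * (c k * a (n - int j + s k)))"
    by (simp add: sum_distrib_left algebra_simps)
  also have "\<dots> = (\<Sum>j = 1..r. p j * (\<Sum>k\<in>K. c k * a (n - int j + s k)))"
    by (subst sum.swap) (simp add: sum_distrib_left)
  finally show "(\<Sum>k\<in>K. c k * a (n + s k)) = (\<Sum>j = 1..r. p j * (\<Sum>k\<in>K. c k * a (n - int j + s k)))" .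
qed

text \<open>Leaving the shift \<open>s k\<close> of column \<open>k\<close> arbitrary lets one
  argument serve both parities. The direction from right to left is what later carries uniqueness
  from the linear system over to the expansion.\<close>

lemma impulse_response_expansion_iff:
  assumes "satisfies_recurrence r p a" and "c \<in> carrier_vec r"
  shows "mat r r (\<lambda>(n, k). a (int n + s k)) *\<^sub>v c = unit_vec r (r - 1) \<longleftrightarrow>
    (\<forall>n. impulse_response r p n = (\<Sum>k<r. c $ k * a (int n + s k)))"
    (is "?M *\<^sub>v c = ?e \<longleftrightarrow> (\<forall>n. _ = ?f (int n))")
proof -
  have row: "(?M *\<^sub>v c) $ n = ?f (int n)" if "n < r" for n
    using that assms(2) by (auto simp: scalar_prod_def atLeast0LessThan mult.commute intro!: sum.cong)
  have rec: "?f x = (\<Sum>j = 1..r. p j * ?f (x - int j))" for x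
    using satisfies_recurrence_sum_shifts[OF assms(1), of "\<lambda>k. c $ k" s "{..<r}"]
    unfolding satisfies_recurrence_def by blast
  show ?thesis
  proof (intro iffI allI)
    fix n
    assume eq: "?M *\<^sub>v c = ?e"
    show "impulse_response r p n = ?f (int n)"
    proof (rule impulse_response_eqI)
      show "?f (int n) = (if n = r - 1 then 1 else 0)" if "n < r" for n
        using row[OF that] that by (simp add: eq)
      \<comment> \<open>As \<open>j \<le> r \<le> n\<close>, the subtraction \<open>n - j\<close> is
        not truncated, so \<open>rec\<close> on the integers specialises to the natural
        numbers.\<close>
      show "?f (int n) = (\<Sum>j = 1..r. p j * ?f (int (n - j)))" if "n \<ge> r" for n
        using that by (subst rec) (auto intro!: sum.cong simp: of_nat_diff)
    qed
  next
    assume eq: "\<forall>n. impulse_response r p n = ?f (int n)"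
    show "?M *\<^sub>v c = ?e"
    proof (rule eq_vecI)
      fix n
      assume "n < dim_vec ?e"
      then have "n < r" by simp
      then have "(?M *\<^sub>v c) $ n = impulse_response r p n" using row eq by presburger
      then show "(?M *\<^sub>v c) $ n = ?e $ n" using \<open>n < r\<close> by (simp add: impulse_response.simps)
    qed simp
  qed
qed

lemma invertible_mat_ex1_solution:
  fixes A :: "'a :: field mat"
  assumes A: "A \<in> carrier_mat n n" and "invertible_mat A" and b: "b \<in> carrier_vec n"
  shows "\<exists>!x. x \<in> carrier_vec n \<and> A *\<^sub>v x = b"
proof -
  from assms(2) obtain B where "inverts_mat A B" "inverts_mat B A"
    unfolding invertible_mat_def by blast
  then have AB: "A * B = 1\<^sub>m n" and BA': "B * A = 1\<^sub>m (dim_row B)"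
    using A by (auto simp: inverts_mat_def)
  \<comment> \<open>\<open>invertible_mat\<close> says nothing about the shape of \<open>B\<close>;
    it is recovered by comparing dimensions on both sides of the two product identities.\<close>
  have "dim_col B = n" using arg_cong[OF AB, of dim_col] by simp
  moreover have "dim_row B = n" using arg_cong[OF BA', of dim_col] A by simp
  ultimately have B: "B \<in> carrier_mat n n" and BA: "B * A = 1\<^sub>m n"
    using BA' by auto
  show ?thesis
  proof (rule ex1I[of _ "B *\<^sub>v b"])
    show "B *\<^sub>v b \<in> carrier_vec n \<and> A *\<^sub>v (B *\<^sub>v b) = b"
      using A B b assoc_mult_mat_vec[OF A B b] by (simp add: AB)
  next
    fix x
    assume "x \<in> carrier_vec n \<and> A *\<^sub>v x = b"
    then show "x = B *\<^sub>v b"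
      using assoc_mult_mat_vec[OF B A, of x] by (simp add: BA)
  qed
qed

text \<open>Moving the case distinction into the shift gives the form
  \<open>a (int n + s k)\<close>. This shift jumps from 1 to -1 at the middle, which is how the
  entry \<open>a n\<close> is skipped.\<close>

lemma A_even_alt:
  "A_even r a = mat r r (\<lambda>(n, k).
     a (int n + (int (r div 2) - int k - (if k < r div 2 then 0 else 1))))"
  unfolding A_even_def by (rule eq_matI) (auto simp: algebra_simps)

text \<open>Substituting \<open>j = k + r div 2\<close> turns the two sums into the halves of one
  sum over \<open>k < r\<close>. Positivity of \<open>r\<close> matters: at 0 the truncated upper
  bounds would leave both ranges with the spurious index 0.\<close>

lemma expansion_even_alt:
  assumes "even r" "r > 0"
  shows "expansion_even r a c n =
    (\<Sum>k<r. c $ k * a (int n + (int (r div 2) - int k - (if k < r div 2 then 0 else 1))))"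
proof -
  obtain m where r: "r = 2 * m" and "m > 0" using assms by auto
  let ?g = "\<lambda>k. c $ k * a (int n + (int m - int k - (if k < m then 0 else 1)))"
  have "(\<Sum>j = m..2 * m - 1. c $ (j - m) * a (int n + int (2 * m) - int j)) = sum ?g {..<m}"
    by (rule sum.reindex_bij_witness[of _ "\<lambda>k. k + m" "\<lambda>j. j - m"])
      (use \<open>m > 0\<close> in \<open>auto simp: algebra_simps of_nat_diff\<close>)
  moreover have "(\<Sum>j = 2 * m..3 * m - 1. c $ (j - m) * a (int n + int (2 * m) - int j - 1)) =
      sum ?g {m..<2 * m}"
    by (rule sum.reindex_bij_witness[of _ "\<lambda>k. k + m" "\<lambda>j. j - m"])
      (use \<open>m > 0\<close> in \<open>auto simp: algebra_simps of_nat_diff\<close>)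
  moreover have "sum ?g {..<m} + sum ?g {m..<2 * m} = sum ?g {..<2 * m}"
    using sum.atLeastLessThan_concat[of 0 m "2 * m" ?g] by (simp add: atLeast0LessThan)
  moreover have "3 * (2 * m) div 2 = 3 * m" by simp
  ultimately show ?thesis
    unfolding expansion_even_def r by (simp del: of_nat_mult)
qed

lemma A_odd_alt: "A_odd r a = mat r r (\<lambda>(n, k). a (int n + (int ((r - 1) div 2) - int k)))"
  unfolding A_odd_def by (simp add: add_diff_eq)

text \<open>With \<open>r = 2 * m + 1\<close> and \<open>j = k + m\<close>, the offset
  \<open>r - j - 1\<close> becomes \<open>m - k\<close>, and the range from \<open>m\<close> to
  \<open>3 * m\<close> becomes \<open>k < r\<close>.\<close>

lemma expansion_odd_alt:
  assumes "odd r"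
  shows "expansion_odd r a c n = (\<Sum>k<r. c $ k * a (int n + (int ((r - 1) div 2) - int k)))"
proof -
  obtain m where r: "r = 2 * m + 1" using assms by (elim oddE)
  have "3 * (r - 1) div 2 = 3 * m" "(r - 1) div 2 = m" by (simp_all add: r)
  then show ?thesis
    unfolding expansion_odd_def
    by (intro sum.reindex_bij_witness[of _ "\<lambda>k. k + m" "\<lambda>j. j - m"])
      (auto simp: r algebra_simps of_nat_diff)
qed

theorem theorem2p5:
  fixes r :: nat and p :: "nat \<Rightarrow> 'a :: field" and a :: "int \<Rightarrow> 'a"
  assumes "r \<ge> 2" and "p r \<noteq> 0" and "satisfies_recurrence r p a"
  shows
    "(even r \<longrightarrow>
        (\<forall>c \<in> carrier_vec r. A_even r a *\<^sub>v c = unit_vec r (r - 1) \<longrightarrow>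
           (\<forall>n. impulse_response r p n = expansion_even r a c n))) \<and>
     (odd r \<longrightarrow>
        (\<forall>c \<in> carrier_vec r. A_odd r a *\<^sub>v c = unit_vec r (r - 1) \<longrightarrow>
           (\<forall>n. impulse_response r p n = expansion_odd r a c n))) \<and>
     (even r \<and> invertible_mat (A_even r a) \<longrightarrow>
        (\<exists>!c. c \<in> carrier_vec r \<and> A_even r a *\<^sub>v c = unit_vec r (r - 1)) \<and>
        (\<exists>!c. c \<in> carrier_vec r \<and> (\<forall>n. impulse_response r p n = expansion_even r a c n))) \<and>
     (odd r \<and> invertible_mat (A_odd r a) \<longrightarrow>
        (\<exists>!c. c \<in> carrier_vec r \<and> A_odd r a *\<^sub>v c = unit_vec r (r - 1)) \<and>
        (\<exists>!c. c \<in> carrier_vec r \<and> (\<forall>n. impulse_response r p n = expansion_odd r a c n)))"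
proof -
  have even: "A_even r a *\<^sub>v c = unit_vec r (r - 1) \<longleftrightarrow>
      (\<forall>n. impulse_response r p n = expansion_even r a c n)"
    if "even r" "c \<in> carrier_vec r" for c
  proof -
    have "r > 0" using assms(1) by simp
    show ?thesis
      unfolding A_even_alt expansion_even_alt[OF \<open>even r\<close> \<open>r > 0\<close>]
      by (rule impulse_response_expansion_iff[OF assms(3) that(2)])
  qed
  have odd: "A_odd r a *\<^sub>v c = unit_vec r (r - 1) \<longleftrightarrow>
      (\<forall>n. impulse_response r p n = expansion_odd r a c n)"
    if "odd r" "c \<in> carrier_vec r" for c
    unfolding A_odd_alt expansion_odd_alt[OF \<open>odd r\<close>]
    by (rule impulse_response_expansion_iff[OF assms(3) that(2)])
  \<comment> \<open>On \<open>carrier_vec r\<close> the system and the property \<open>P\<close>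
    have the same solutions, so unique solvability of the system gives both claims; \<open>P\<close>
    will be the validity of the expansion.\<close>
  have ex1: "(\<exists>!c. c \<in> carrier_vec r \<and> A *\<^sub>v c = unit_vec r (r - 1)) \<and> (\<exists>!c. c \<in> carrier_vec r \<and> P c)"
    if "A \<in> carrier_mat r r" "invertible_mat A"
      and "\<And>c. c \<in> carrier_vec r \<Longrightarrow> A *\<^sub>v c = unit_vec r (r - 1) \<longleftrightarrow> P c"
    for A :: "'a mat" and P
  proof -
    have "(c \<in> carrier_vec r \<and> P c) = (c \<in> carrier_vec r \<and> A *\<^sub>v c = unit_vec r (r - 1))" for c
      using that(3) by blast
    then show ?thesis
      using invertible_mat_ex1_solution[OF that(1,2) unit_vec_carrier] by (simp only:)
  qed
  have "A_even r a \<in> carrier_mat r r" "A_odd r a \<in> carrier_mat r r"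
    by (simp_all add: A_even_def A_odd_def)
  then show ?thesis
    using even odd
      ex1[of "A_even r a" "\<lambda>c. \<forall>n. impulse_response r p n = expansion_even r a c n"]
      ex1[of "A_odd r a" "\<lambda>c. \<forall>n. impulse_response r p n = expansion_odd r a c n"]
    by auto
qed

end
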